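(* Let $M$ be a $3$-dimensional Riemannian space form of constant sectional curvature with space form vector $\mathfrak{q}$, let $f_{0,0}$ be a smooth surface of constant mean curvature $H$ in $M$, and let $\{f_{m,n}\}_{m,n\ge 0}$ be a lattice of CMC Darboux transforms of $f_{0,0}$ (as defined in the context). Then for every $x\in\Sigma^2$ the discrete map $F_{(m,n)}:=f_{m,n}(x)$ is a discrete constant mean curvature $H$ surface in $M$; that is, discrete constant mean curvature $H$ surfaces in $M$ are obtained as Bianchi quadrilaterals of CMC Darboux transformations. In particular, when $M$ is Euclidean $3$-space, discrete constant mean curvature $H$ surfaces are obtained in this way as Bianchi quadrilaterals of Bianchi-B\"acklund transformations.
   Context: Ambient space. $\mathbb{R}^{4,1}$ carries the metric $(\cdot,\cdot)$ of signature $(4,1)$ with light cone $\mathcal{L}$; $\mathbb{P}(\mathcal{L})$ is the conformal $3$-sphere. For nonzero $\mathfrak{q}\in\mathbb{R}^{4,1}$, $M=\{X\in\mathcal{L}:(X,\mathfrak{q})=-1\}$ is a space form of constant sectional curvature (Euclidean when $(\mathfrak{q},\mathfrak{q})=0$). $\Sigma^2$ is a simply connected surface; a surface $f:\Sigma^2\to\mathbb{P}(\mathcal{L})$ is viewed as a null line subbundle of $\Sigma^2\times\mathbb{R}^{4,1}$, and the corresponding surface in $M$ is $f\cap M$ (where $f\not\perp\mathfrak{q}$). We identify $\wedge^2\mathbb{R}^{4,1}\cong\mathfrak{o}(4,1)$ via $(u\wedge v)w=(u,w)v-(v,w)u$. For non-orthogonal null lines $a,b$ and $s\in\mathbb{R}\setminus\{0\}$,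 $\Gamma_a^b(s)$ is the orthogonal map acting as $s$ on $b$, $s^{-1}$ on $a$, and the identity on $(a\oplus b)^\perp$. Smooth surfaces. $f$ (umbilic-free) is isothermic, with associated form $\eta$, if $\eta\in\Omega^1(f\wedge f^\perp)$ is closed and nowhere zero; its associated connections $\Gamma(t)=d+t\eta$ are flat. A Darboux transform of $f$ with parameter $\mu\in\mathbb{R}\setminus\{0\}$ is a surface $\hat f$, nowhere orthogonal to $f$, whose line bundle is $\Gamma(\mu)$-parallel; it is isothermic with connections $\hat\Gamma(t)=\Gamma_f^{\hat f}(1-\tfrac t\mu)\circ\Gamma(t)\circ\Gamma_f^{\hat f}(1-\tfrac t\mu)^{-1}$. Smooth constant mean curvature $H$ surfaces in $M$ are characterized as the isothermic surfaces admitting a linear conserved quantity $p(t)=\mathfrak{q}+tY$, i.e. $\Gamma(t)p(t)=0$ for all $t$, with $Y:\Sigma^2\to\mathbb{R}^{4,1}$, $(Y,Y)=1$ and $H=-(\mathfrak{q},Y)$. A CMC Darboux transform of such $f$ is a Darboux transform $\hat f$ (with parameter $\mu$) satisfying $p(\mu)\perp\hat f$; then $\hat f$ is again of constant mean curvature $H$ in $M$, with linear conserved quantity $\hat p(t)=\Gamma_f^{\hat f}(1-\tfrac t\mu)p(t)$. When $M$ is Euclidean $3$-space, CMC Darboux transformations are equivalent to the classical Bianchi-B\"acklund transformations, and "Bianchi-B\"acklund transformation" is used here in that equivalent sense. Lattice. If $f_j,f_\ell$ are Darboux transforms of $f_i$ with parameters $m_{ij}\ne m_{i\ell}$, Bianchi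 permutability gives the fourth surface $f_k=\Gamma_{f_i}^{f_j}(1-\tfrac{m_{i\ell}}{m_{ij}})f_\ell=\Gamma_{f_i}^{f_\ell}(1-\tfrac{m_{ij}}{m_{i\ell}})f_j$, simultaneously a Darboux transform of $f_j$ with parameter $m_{i\ell}$ and of $f_\ell$ with parameter $m_{ij}$. In a lattice of CMC Darboux transforms, $f_{m+1,0}$ is a CMC Darboux transform of $f_{m,0}$ with parameter $\alpha_m$, $f_{0,n+1}$ one of $f_{0,n}$ with parameter $\beta_n$ (with respect to the successively induced linear conserved quantities), $\alpha_m\neq\beta_n$, and all other $f_{m,n}$ are determined by Bianchi permutability on elementary quadrilaterals (a Bianchi quadrilateral consists of the four points of such surfaces at a common $x$). All surfaces are assumed nondegenerate as needed: surfaces adjacent in the lattice are nowhere orthogonal, and $f_{m,n}\not\perp\mathfrak{q}$. Discrete surfaces. Write $i=(m,n)$, $j=(m+1,n)$, $k=(m+1,n+1)$, $\ell=(m,n+1)$. A discrete map $F:(\mathbb{Z}_{\ge 0})^2\to\mathbb{P}(\mathcal{L})$ with adjacent values non-orthogonal is discrete isothermic if there is a real non-vanishing edge-labeling with $m_{ij}=m_{\ell k}$, $m_{i\ell}=m_{jk}$ such that $\Gamma(t)_{ji}:=\Gamma_{F_i}^{F_j}(1-\tfrac t{m_{ij}})$ satisfies $\Gamma(t)_{kj}\Gamma(t)_{ji}=\Gamma(t)_{k\ell}\Gamma(t)_{\ell i}$ for all $t$ (where defined). A discrete constant mean curvature $H$ surface in $M$ is a discrete isothermic $F$ admitting $P(t)_i=\mathfrak{q}+tY_i$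 with $\Gamma(t)_{ji}P(t)_i=P(t)_j$ on all edges, $(Y_i,Y_i)=1$ and $H=-(\mathfrak{q},Y_i)$. *)

theory Defs
  imports "HOL-Analysis.Analysis"
begin

section \<open>The space \<open>\<real>\<^sup>4\<^sup>,\<^sup>1\<close>, its light cone and space forms\<close>

type_synonym r41 = "(real ^ 4) \<times> real"

definition lorentz :: "r41 \<Rightarrow> r41 \<Rightarrow> real" where
  "lorentz u v = fst u \<bullet> fst v - snd u * snd v"

definition light_cone :: "r41 set" where
  "light_cone = {X. lorentz X X = 0}"

definition conformal_sphere :: "r41 set set" where
  "conformal_sphere = {span {v} | v. v \<in> light_cone \<and> v \<noteq> 0}"

definition perp :: "r41 set \<Rightarrow> r41 set" where
  "perp A = {w. \<forall>v\<in>A. lorentz w v = 0}"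

definition orthogonal_lines :: "r41 set \<Rightarrow> r41 set \<Rightarrow> bool" where
  "orthogonal_lines a b \<longleftrightarrow> a \<subseteq> perp b"

definition space_form :: "r41 \<Rightarrow> r41 set" where
  "space_form q = {X \<in> light_cone. lorentz X q = - 1}"

text \<open>A null line \<open>a\<close> represents the single point of \<open>a \<inter> space_form q\<close>; this
  intersection is nonempty exactly when \<open>a\<close> is not orthogonal to \<open>q\<close>.\<close>

definition point_in_space_form :: "r41 \<Rightarrow> r41 set \<Rightarrow> bool" where
  "point_in_space_form q a \<longleftrightarrow> a \<inter> space_form q \<noteq> {}"

text \<open>The element \<open>u \<and> v\<close> of \<open>\<and>\<^sup>2\<real>\<^sup>4\<^sup>,\<^sup>1\<close>, regarded as an element of \<open>o(4,1)\<close>.\<close>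

definition wedge :: "r41 \<Rightarrow> r41 \<Rightarrow> r41 \<Rightarrow> r41" where
  "wedge u v w = lorentz u w *\<^sub>R v - lorentz v w *\<^sub>R u"

text \<open>\<open>line_boost a b s\<close> is \<open>\<Gamma>\<^sub>a\<^sup>b(s)\<close>; it is meaningful only for non-orthogonal null
  lines \<open>a\<close>, \<open>b\<close> and \<open>s \<noteq> 0\<close>.\<close>

definition line_boost :: "r41 set \<Rightarrow> r41 set \<Rightarrow> real \<Rightarrow> r41 \<Rightarrow> r41" where
  "line_boost a b s = (THE T. linear T \<and> (\<forall>v\<in>b. T v = s *\<^sub>R v)
      \<and> (\<forall>u\<in>a. T u = inverse s *\<^sub>R u) \<and> (\<forall>w \<in> perp (a \<union> b). T w = w))"


section \<open>Smooth surfaces\<close>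

definition dir_deriv :: "('b::real_normed_vector \<Rightarrow> 'c::real_normed_vector) \<Rightarrow> 'b \<Rightarrow> 'b \<Rightarrow> 'c" where
  "dir_deriv g y v = frechet_derivative g (at y) v"

primrec Ck_on :: "nat \<Rightarrow> 'b::real_normed_vector set \<Rightarrow> ('b \<Rightarrow> 'c::real_normed_vector) \<Rightarrow> bool" where
  "Ck_on 0 U g \<longleftrightarrow> continuous_on U g"
| "Ck_on (Suc k) U g \<longleftrightarrow>
     (\<forall>y\<in>U. g differentiable (at y)) \<and> (\<forall>v. Ck_on k U (\<lambda>y. dir_deriv g y v))"

definition smooth_on :: "'b::real_normed_vector set \<Rightarrow> ('b \<Rightarrow> 'c::real_normed_vector) \<Rightarrow> bool" where
  "smooth_on U g \<longleftrightarrow> (\<forall>k. Ck_on k U g)"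

text \<open>An abstract smooth 2-manifold \<open>S\<close> is given by an atlas of local parametrizations
  \<open>(V, \<psi>)\<close>, where \<open>\<psi>\<close> maps the open set \<open>V\<close> of the plane homeomorphically onto an open
  subset of \<open>S\<close>; the maps \<open>\<psi>\<inverse>\<close> are the charts.\<close>

type_synonym 'a param = "(real ^ 2) set \<times> (real ^ 2 \<Rightarrow> 'a)"

definition transition :: "'a param \<Rightarrow> 'a param \<Rightarrow> real ^ 2 \<Rightarrow> real ^ 2" where
  "transition c c' y = inv_into (fst c') (snd c') (snd c y)"

definition overlap :: "'a param \<Rightarrow> 'a param \<Rightarrow> (real ^ 2) set" where
  "overlap c c' = {y \<in> fst c. snd c y \<in> snd c' ` fst c'}"

definition smooth_2_manifold :: "'a::topological_space set \<Rightarrow> 'a param set \<Rightarrow> bool" where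
  "smooth_2_manifold S A \<longleftrightarrow>
     Hausdorff_space (top_of_set S) \<and> second_countable (top_of_set S) \<and>
     (\<forall>(V, \<psi>)\<in>A. open V \<and> openin (top_of_set S) (\<psi> ` V)
        \<and> (\<exists>\<phi>. homeomorphism V (\<psi> ` V) \<psi> \<phi>)) \<and>
     (\<Union>(V, \<psi>)\<in>A. \<psi> ` V) = S \<and>
     (\<forall>c\<in>A. \<forall>c'\<in>A. smooth_on (overlap c c') (transition c c'))"

definition smooth_map :: "'a param set \<Rightarrow> ('a \<Rightarrow> 'c::real_normed_vector) \<Rightarrow> bool" where
  "smooth_map A g \<longleftrightarrow> (\<forall>(V, \<psi>)\<in>A. smooth_on V (g \<circ> \<psi>))"


section \<open>Surfaces in the conformal 3-sphere\<close>

text \<open>A map into the conformal 3-sphere assigns to each point of the manifold a null line, i.e.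
  it is a null line subbundle; its (local) lifts are the nowhere zero sections.\<close>

definition local_section :: "'a param \<Rightarrow> ('a \<Rightarrow> r41 set) \<Rightarrow> (real ^ 2) set \<Rightarrow> (real ^ 2 \<Rightarrow> r41) \<Rightarrow> bool" where
  "local_section c f W \<sigma> \<longleftrightarrow>
     open W \<and> W \<subseteq> fst c \<and> smooth_on W \<sigma> \<and> (\<forall>y\<in>W. \<sigma> y \<in> f (snd c y))"

definition local_lift :: "'a param \<Rightarrow> ('a \<Rightarrow> r41 set) \<Rightarrow> (real ^ 2) set \<Rightarrow> (real ^ 2 \<Rightarrow> r41) \<Rightarrow> bool" where
  "local_lift c f W F \<longleftrightarrow> local_section c f W F \<and> (\<forall>y\<in>W. F y \<noteq> 0)"

text \<open>\<open>f\<close> is a smooth immersion into the conformal 3-sphere: the differential of a lift is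
  injective modulo the line.\<close>

definition conformal_surface :: "'a set \<Rightarrow> 'a param set \<Rightarrow> ('a \<Rightarrow> r41 set) \<Rightarrow> bool" where
  "conformal_surface S A f \<longleftrightarrow>
     (\<forall>x\<in>S. f x \<in> conformal_sphere) \<and>
     (\<forall>c\<in>A. \<forall>y\<in>fst c. \<exists>W F. y \<in> W \<and> local_lift c f W F
        \<and> (\<forall>v. dir_deriv F y v \<in> f (snd c y) \<longrightarrow> v = 0))"

text \<open>The second fundamental form with respect to a unit normal \<open>N\<close> is proportional to the
  first. For the lift into a space form and \<open>N \<perp> q\<close> this is the usual definition of an
  umbilic point there; since \<open>N\<close> is determined by a lift only up to sign and multiples of
  that lift, and replacing \<open>N\<close> by \<open>N + r F\<close> subtracts \<open>r\<close> times the first fundamental form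
  from the second, the condition does not depend on the choices.\<close>

definition umbilic_at :: "'a param \<Rightarrow> ('a \<Rightarrow> r41 set) \<Rightarrow> real ^ 2 \<Rightarrow> bool" where
  "umbilic_at c f y \<longleftrightarrow>
     (\<exists>W F N \<kappa>. y \<in> W \<and> local_lift c f W F \<and>
        lorentz N N = 1 \<and> lorentz N (F y) = 0 \<and> (\<forall>u. lorentz N (dir_deriv F y u) = 0) \<and>
        (\<forall>u v. lorentz N (dir_deriv (\<lambda>z. dir_deriv F z u) y v)
             = \<kappa> * lorentz (dir_deriv F y u) (dir_deriv F y v)))"

definition umbilic_free :: "'a param set \<Rightarrow> ('a \<Rightarrow> r41 set) \<Rightarrow> bool" where
  "umbilic_free A f \<longleftrightarrow> (\<forall>c\<in>A. \<forall>y\<in>fst c. \<not> umbilic_at c f y)"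


section \<open>Isothermic surfaces and their connections\<close>

text \<open>A 1-form with values in endomorphisms of \<open>\<real>\<^sup>4\<^sup>,\<^sup>1\<close> is given by its local
  representatives: \<open>\<eta> (V, \<psi>) y v w\<close> is \<open>\<eta>(d\<psi>\<^sub>y(v)) w\<close>.\<close>

type_synonym 'a endo_form = "'a param \<Rightarrow> real ^ 2 \<Rightarrow> real ^ 2 \<Rightarrow> r41 \<Rightarrow> r41"

definition smooth_endo_form :: "'a param set \<Rightarrow> 'a endo_form \<Rightarrow> bool" where
  "smooth_endo_form A \<eta> \<longleftrightarrow>
     (\<forall>c\<in>A. (\<forall>y\<in>fst c. (\<forall>w. linear (\<lambda>v. \<eta> c y v w)) \<and> (\<forall>v. linear (\<eta> c y v)))
        \<and> (\<forall>v w. smooth_on (fst c) (\<lambda>y. \<eta> c y v w))) \<and>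
     (\<forall>c\<in>A. \<forall>c'\<in>A. \<forall>y \<in> overlap c c'. \<forall>v.
        \<eta> c y v = \<eta> c' (transition c c' y) (dir_deriv (transition c c') y v))"

definition closed_form :: "'a param set \<Rightarrow> 'a endo_form \<Rightarrow> bool" where
  "closed_form A \<eta> \<longleftrightarrow>
     (\<forall>c\<in>A. \<forall>y\<in>fst c. \<forall>u v w.
        dir_deriv (\<lambda>z. \<eta> c z v w) y u = dir_deriv (\<lambda>z. \<eta> c z u w) y v)"

definition nowhere_zero_form :: "'a param set \<Rightarrow> 'a endo_form \<Rightarrow> bool" where
  "nowhere_zero_form A \<eta> \<longleftrightarrow> (\<forall>c\<in>A. \<forall>y\<in>fst c. \<exists>v w. \<eta> c y v w \<noteq> 0)"

text \<open>As \<open>f\<close> is a line bundle, every element of \<open>f \<and> f\<^sup>\<perp>\<close> is decomposable.\<close>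

definition isothermic :: "'a set \<Rightarrow> 'a param set \<Rightarrow> ('a \<Rightarrow> r41 set) \<Rightarrow> 'a endo_form \<Rightarrow> bool" where
  "isothermic S A f \<eta> \<longleftrightarrow>
     conformal_surface S A f \<and> umbilic_free A f \<and> smooth_endo_form A \<eta> \<and>
     (\<forall>c\<in>A. \<forall>y\<in>fst c. \<forall>v. \<exists>u \<in> f (snd c y). \<exists>w \<in> perp (f (snd c y)). \<eta> c y v = wedge u w) \<and>
     closed_form A \<eta> \<and> nowhere_zero_form A \<eta>"

text \<open>The connection \<open>\<Gamma>(t) = d + t\<eta>\<close> acting on a section \<open>\<sigma>\<close> (expressed in the
  parametrization \<open>c\<close>), at \<open>y\<close> in direction \<open>v\<close>.\<close>

definition connection ::
    "'a endo_form \<Rightarrow> real \<Rightarrow> 'a param \<Rightarrow> (real ^ 2 \<Rightarrow> r41) \<Rightarrow> real ^ 2 \<Rightarrow> real ^ 2 \<Rightarrow> r41" where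
  "connection \<eta> t c \<sigma> y v = dir_deriv \<sigma> y v + t *\<^sub>R \<eta> c y v (\<sigma> y)"

definition parallel_line_bundle ::
    "'a param set \<Rightarrow> 'a endo_form \<Rightarrow> real \<Rightarrow> ('a \<Rightarrow> r41 set) \<Rightarrow> bool" where
  "parallel_line_bundle A \<eta> t g \<longleftrightarrow>
     (\<forall>c\<in>A. \<forall>W \<sigma>. local_section c g W \<sigma> \<longrightarrow>
        (\<forall>y\<in>W. \<forall>v. connection \<eta> t c \<sigma> y v \<in> g (snd c y)))"

definition darboux_transform ::
    "'a set \<Rightarrow> 'a param set \<Rightarrow> ('a \<Rightarrow> r41 set) \<Rightarrow> 'a endo_form \<Rightarrow> real \<Rightarrow> ('a \<Rightarrow> r41 set) \<Rightarrow> bool" where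
  "darboux_transform S A f \<eta> \<mu> g \<longleftrightarrow>
     \<mu> \<noteq> 0 \<and> conformal_surface S A g \<and> (\<forall>x\<in>S. \<not> orthogonal_lines (f x) (g x)) \<and>
     parallel_line_bundle A \<eta> \<mu> g"

text \<open>The form \<open>\<eta>'\<close> of the Darboux transform \<open>g\<close>, determined by
  \<open>d + t\<eta>' = G(t) \<circ> (d + t\<eta>) \<circ> G(t)\<inverse>\<close> with \<open>G(t) = \<Gamma>\<^sub>f\<^sup>g(1 - t/\<mu>)\<close> for all
  \<open>t \<noteq> \<mu>\<close>. A connection form is determined by the action of the connection on constant
  sections \<open>w\<close>.\<close>

definition darboux_form ::
    "('a \<Rightarrow> r41 set) \<Rightarrow> ('a \<Rightarrow> r41 set) \<Rightarrow> real \<Rightarrow> 'a endo_form \<Rightarrow> 'a endo_form" where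
  "darboux_form f g \<mu> \<eta> c y v =
     (THE B. \<forall>t. t \<noteq> \<mu> \<longrightarrow> (\<forall>w.
        t *\<^sub>R B w = line_boost (f (snd c y)) (g (snd c y)) (1 - t / \<mu>)
          (connection \<eta> t c
             (\<lambda>z. inv (line_boost (f (snd c z)) (g (snd c z)) (1 - t / \<mu>)) w) y v)))"


section \<open>Constant mean curvature surfaces and their Darboux transforms\<close>

text \<open>Constant mean curvature surfaces are understood as isothermic surfaces with a linear
  conserved quantity \<open>p(t) = q + tY\<close>, encoded by \<open>Y\<close>. For the lift \<open>X\<close> of such a surface
  into the space form, with unit normal \<open>N\<close>, one has \<open>Y = N + H X\<close>.\<close>

definition linear_conserved_quantity ::
    "'a param set \<Rightarrow> 'a endo_form \<Rightarrow> r41 \<Rightarrow> ('a \<Rightarrow> r41) \<Rightarrow> bool" where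
  "linear_conserved_quantity A \<eta> q Y \<longleftrightarrow>
     smooth_map A Y \<and>
     (\<forall>t. \<forall>c\<in>A. \<forall>y\<in>fst c. \<forall>v. connection \<eta> t c (\<lambda>z. q + t *\<^sub>R Y (snd c z)) y v = 0)"

definition cmc_surface ::
    "'a set \<Rightarrow> 'a param set \<Rightarrow> r41 \<Rightarrow> real \<Rightarrow> ('a \<Rightarrow> r41 set) \<Rightarrow> 'a endo_form \<Rightarrow> ('a \<Rightarrow> r41) \<Rightarrow> bool" where
  "cmc_surface S A q H f \<eta> Y \<longleftrightarrow>
     isothermic S A f \<eta> \<and> (\<forall>x\<in>S. point_in_space_form q (f x)) \<and>
     linear_conserved_quantity A \<eta> q Y \<and>
     (\<forall>x\<in>S. lorentz (Y x) (Y x) = 1 \<and> H = - lorentz q (Y x))"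

definition cmc_darboux_transform ::
    "'a set \<Rightarrow> 'a param set \<Rightarrow> r41 \<Rightarrow> ('a \<Rightarrow> r41 set) \<Rightarrow> 'a endo_form \<Rightarrow> ('a \<Rightarrow> r41) \<Rightarrow> real
      \<Rightarrow> ('a \<Rightarrow> r41 set) \<Rightarrow> bool" where
  "cmc_darboux_transform S A q f \<eta> Y \<mu> g \<longleftrightarrow>
     darboux_transform S A f \<eta> \<mu> g \<and> (\<forall>x\<in>S. q + \<mu> *\<^sub>R Y x \<in> perp (g x))"

text \<open>In Euclidean 3-space, i.e. for null \<open>q\<close>, the classical Bianchi-Baecklund
  transformations are the CMC Darboux transformations; they are understood in this sense.\<close>

definition bianchi_backlund_transform ::
    "'a set \<Rightarrow> 'a param set \<Rightarrow> r41 \<Rightarrow> ('a \<Rightarrow> r41 set) \<Rightarrow> 'a endo_form \<Rightarrow> ('a \<Rightarrow> r41) \<Rightarrow> real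
      \<Rightarrow> ('a \<Rightarrow> r41 set) \<Rightarrow> bool" where
  "bianchi_backlund_transform S A q f \<eta> Y \<mu> g \<longleftrightarrow>
     lorentz q q = 0 \<and> cmc_darboux_transform S A q f \<eta> Y \<mu> g"

text \<open>The linear coefficient of the polynomial extending
  \<open>t \<mapsto> \<Gamma>\<^sub>f\<^sup>g(1 - t/\<mu>)(q + tY)\<close> to \<open>t = \<mu>\<close>.\<close>

definition darboux_quantity ::
    "('a \<Rightarrow> r41 set) \<Rightarrow> ('a \<Rightarrow> r41 set) \<Rightarrow> real \<Rightarrow> r41 \<Rightarrow> ('a \<Rightarrow> r41) \<Rightarrow> 'a \<Rightarrow> r41" where
  "darboux_quantity f g \<mu> q Y x =
     (THE Z. \<forall>t. t \<noteq> \<mu> \<longrightarrow>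
        q + t *\<^sub>R Z = line_boost (f x) (g x) (1 - t / \<mu>) (q + t *\<^sub>R Y x))"

text \<open>The data induced along a sequence \<open>g 0, g 1, \<dots>\<close> of successive Darboux transforms with
  parameters \<open>\<mu> 0, \<mu> 1, \<dots>\<close>.\<close>

primrec induced_form ::
    "(nat \<Rightarrow> 'a \<Rightarrow> r41 set) \<Rightarrow> (nat \<Rightarrow> real) \<Rightarrow> 'a endo_form \<Rightarrow> nat \<Rightarrow> 'a endo_form" where
  "induced_form g \<mu> \<eta> 0 = \<eta>"
| "induced_form g \<mu> \<eta> (Suc m) = darboux_form (g m) (g (Suc m)) (\<mu> m) (induced_form g \<mu> \<eta> m)"

primrec induced_quantity ::
    "(nat \<Rightarrow> 'a \<Rightarrow> r41 set) \<Rightarrow> (nat \<Rightarrow> real) \<Rightarrow> r41 \<Rightarrow> ('a \<Rightarrow> r41) \<Rightarrow> nat \<Rightarrow> 'a \<Rightarrow> r41" where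
  "induced_quantity g \<mu> q Y 0 = Y"
| "induced_quantity g \<mu> q Y (Suc m) =
     darboux_quantity (g m) (g (Suc m)) (\<mu> m) q (induced_quantity g \<mu> q Y m)"

text \<open>\<open>T f \<eta> Y \<mu> g\<close> says that \<open>g\<close> is a transform of \<open>f\<close> of the type considered.\<close>

definition transform_sequence ::
    "(('a \<Rightarrow> r41 set) \<Rightarrow> 'a endo_form \<Rightarrow> ('a \<Rightarrow> r41) \<Rightarrow> real \<Rightarrow> ('a \<Rightarrow> r41 set) \<Rightarrow> bool)
      \<Rightarrow> r41 \<Rightarrow> 'a endo_form \<Rightarrow> ('a \<Rightarrow> r41) \<Rightarrow> (nat \<Rightarrow> real) \<Rightarrow> (nat \<Rightarrow> 'a \<Rightarrow> r41 set) \<Rightarrow> bool" where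
  "transform_sequence T q \<eta> Y \<mu> g \<longleftrightarrow>
     (\<forall>m. T (g m) (induced_form g \<mu> \<eta> m) (induced_quantity g \<mu> q Y m) (\<mu> m) (g (Suc m)))"

text \<open>\<open>b\<close> and \<open>d\<close> are transforms of \<open>a\<close> with parameters \<open>\<mu>\<close> and \<open>\<nu>\<close>, and
  \<open>c = \<Gamma>\<^sub>a\<^sup>b(1 - \<nu>/\<mu>) d\<close> is the fourth point given by Bianchi permutability. If no
  two adjacent points of the quadrilateral are orthogonal and \<open>\<mu> \<noteq> \<nu>\<close> are nonzero, then also
  \<open>c = \<Gamma>\<^sub>a\<^sup>d(1 - \<mu>/\<nu>) b\<close>.\<close>

definition bianchi_quadrilateral ::
    "real \<Rightarrow> real \<Rightarrow> r41 set \<Rightarrow> r41 set \<Rightarrow> r41 set \<Rightarrow> r41 set \<Rightarrow> bool" where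
  "bianchi_quadrilateral \<mu> \<nu> a b c d \<longleftrightarrow> c = line_boost a b (1 - \<nu> / \<mu>) ` d"

definition transform_lattice ::
    "'a set \<Rightarrow> (('a \<Rightarrow> r41 set) \<Rightarrow> 'a endo_form \<Rightarrow> ('a \<Rightarrow> r41) \<Rightarrow> real \<Rightarrow> ('a \<Rightarrow> r41 set) \<Rightarrow> bool)
      \<Rightarrow> r41 \<Rightarrow> 'a endo_form \<Rightarrow> ('a \<Rightarrow> r41) \<Rightarrow> (nat \<Rightarrow> real) \<Rightarrow> (nat \<Rightarrow> real)
      \<Rightarrow> (nat \<Rightarrow> nat \<Rightarrow> 'a \<Rightarrow> r41 set) \<Rightarrow> bool" where
  "transform_lattice S T q \<eta> Y \<alpha> \<beta> f \<longleftrightarrow>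
     transform_sequence T q \<eta> Y \<alpha> (\<lambda>m. f m 0) \<and>
     transform_sequence T q \<eta> Y \<beta> (\<lambda>n. f 0 n) \<and>
     (\<forall>m n. \<alpha> m \<noteq> \<beta> n) \<and>
     (\<forall>m n. \<forall>x\<in>S. bianchi_quadrilateral (\<alpha> m) (\<beta> n)
        (f m n x) (f (Suc m) n x) (f (Suc m) (Suc n) x) (f m (Suc n) x)) \<and>
     (\<forall>m n. \<forall>x\<in>S. \<not> orthogonal_lines (f m n x) (f (Suc m) n x)
        \<and> \<not> orthogonal_lines (f m n x) (f m (Suc n) x)) \<and>
     (\<forall>m n. \<forall>x\<in>S. point_in_space_form q (f m n x))"


section \<open>Discrete constant mean curvature surfaces\<close>

text \<open>\<open>a m n\<close> labels the edge from \<open>(m, n)\<close> to \<open>(m + 1, n)\<close>, and \<open>b m n\<close> the edge from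
  \<open>(m, n)\<close> to \<open>(m, n + 1)\<close>.\<close>

definition discrete_isothermic ::
    "(nat \<Rightarrow> nat \<Rightarrow> r41 set) \<Rightarrow> (nat \<Rightarrow> nat \<Rightarrow> real) \<Rightarrow> (nat \<Rightarrow> nat \<Rightarrow> real) \<Rightarrow> bool" where
  "discrete_isothermic F a b \<longleftrightarrow>
     (\<forall>m n. F m n \<in> conformal_sphere
        \<and> \<not> orthogonal_lines (F m n) (F (Suc m) n)
        \<and> \<not> orthogonal_lines (F m n) (F m (Suc n))) \<and>
     (\<forall>m n. a m n \<noteq> 0 \<and> b m n \<noteq> 0 \<and> a m n = a m (Suc n) \<and> b m n = b (Suc m) n) \<and>
     (\<forall>m n t. t \<noteq> a m n \<and> t \<noteq> b m n \<longrightarrow>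
        line_boost (F (Suc m) n) (F (Suc m) (Suc n)) (1 - t / b (Suc m) n)
          \<circ> line_boost (F m n) (F (Suc m) n) (1 - t / a m n)
        = line_boost (F m (Suc n)) (F (Suc m) (Suc n)) (1 - t / a m (Suc n))
          \<circ> line_boost (F m n) (F m (Suc n)) (1 - t / b m n))"

definition discrete_cmc_surface :: "r41 \<Rightarrow> real \<Rightarrow> (nat \<Rightarrow> nat \<Rightarrow> r41 set) \<Rightarrow> bool" where
  "discrete_cmc_surface q H F \<longleftrightarrow>
     (\<forall>m n. point_in_space_form q (F m n)) \<and>
     (\<exists>a b Y. discrete_isothermic F a b \<and>
        (\<forall>m n t. t \<noteq> a m n \<longrightarrow>
           line_boost (F m n) (F (Suc m) n) (1 - t / a m n) (q + t *\<^sub>R Y m n)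
             = q + t *\<^sub>R Y (Suc m) n) \<and>
        (\<forall>m n t. t \<noteq> b m n \<longrightarrow>
           line_boost (F m n) (F m (Suc n)) (1 - t / b m n) (q + t *\<^sub>R Y m n)
             = q + t *\<^sub>R Y m (Suc n)) \<and>
        (\<forall>m n. lorentz (Y m n) (Y m n) = 1 \<and> H = - lorentz q (Y m n)))"

end

theory Submission
  imports Defs
begin

text \<open>
  The conclusion concerns the values of the surfaces at one point \<open>x\<close>, and there it is a
  statement about null lines. With respect to \<open>a \<oplus> b \<oplus> (a \<oplus> b)\<^sup>\<perp>\<close> the map
  \<open>\<Gamma>\<^sub>a\<^sup>b(1 - t/\<mu>)\<close> multiplies the \<open>b\<close>-component of \<open>q + tY\<close> by \<open>1 - t/\<mu>\<close> and divides
  the \<open>a\<close>-component by it. If \<open>Y \<perp> a\<close>, then the \<open>b\<close>-component is constant in \<open>t\<close> and no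
  quadratic term arises; if \<open>q + \<mu>Y \<perp> b\<close>, then the \<open>a\<close>-component vanishes at \<open>t = \<mu>\<close> and
  the pole cancels. Under these two conditions the image is again of the form \<open>q + tZ\<close>, and
  \<open>Z \<perp> b\<close> (\<open>conserved_along_edge_exists\<close>). Since boosts are isometries, comparing
  coefficients of \<open>t\<close> gives \<open>(Z, Z) = (Y, Y)\<close> and \<open>(q, Z) = (q, Y)\<close>, so the normalization
  and the mean curvature propagate.

  It remains to see that the two conditions hold on every edge and that the quantities agree
  around every quadrilateral.

  \<^item> At \<open>f 0 0\<close>, the \<open>t\<^sup>2\<close>-coefficient of \<open>(d + t\<eta>)(q + tY) = 0\<close> is \<open>\<eta> Y = 0\<close>. As \<open>\<eta>\<close>
    takes values in \<open>f \<and> f\<^sup>\<perp>\<close> and has no zeros, \<open>Y \<perp> f\<close>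
    (\<open>linear_conserved_quantity_perp\<close>). The first condition then reproduces itself along
    edges, because \<open>Z \<perp> b\<close>.
  \<^item> On the two axes the second condition is part of the definition of a CMC Darboux
    transform. If \<open>c = \<Gamma>\<^sub>a\<^sup>b(1 - \<nu>/\<mu>) d\<close>, then evaluating the conserved quantity at
    \<open>t = \<nu>\<close> shows that this isometry maps \<open>q + \<nu>Y\<close> to \<open>q + \<nu>Z\<close>; hence the condition
    \<open>q + \<nu>Y \<perp> d\<close> is carried to \<open>q + \<nu>Z \<perp> c\<close> on the opposite edge
    (\<open>conserved_along_edge_opposite_perp\<close>).
  \<^item> The quantities agree because the connection is flat on a Bianchi quadrilateral: the
    transport \<open>\<Gamma>\<^sub>b\<^sup>c(1 - t/\<nu>) \<Gamma>\<^sub>a\<^sup>b(1 - t/\<mu>)\<close> from \<open>a\<close> over \<open>b\<close> to \<open>c\<close> is itself a boost,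
    namely \<open>\<Gamma>\<^sub>b\<^sup>d(r)\<close> with \<open>r = (1 - t/\<nu>)/(1 - t/\<mu>)\<close>. Exchanging the roles of \<open>(b, \<mu>)\<close>
    and \<open>(d, \<nu>)\<close> gives \<open>\<Gamma>\<^sub>d\<^sup>b(1/r)\<close> for the transport over \<open>d\<close>, which is the same map
    (\<open>bianchi_permutability\<close>).
\<close>


section \<open>The Lorentz form and null lines\<close>

lemma lorentz_commute: "lorentz u v = lorentz v u"
  by (simp add: lorentz_def inner_commute mult.commute)

lemma lorentz_algebra [simp]:
  "lorentz (u + v) w = lorentz u w + lorentz v w"
  "lorentz (u - v) w = lorentz u w - lorentz v w"
  "lorentz w (u + v) = lorentz w u + lorentz w v"
  "lorentz w (u - v) = lorentz w u - lorentz w v"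
  "lorentz (r *\<^sub>R u) w = r * lorentz u w"
  "lorentz w (r *\<^sub>R u) = r * lorentz w u"
  "lorentz 0 w = 0" "lorentz w 0 = 0"
  by (simp_all add: lorentz_def algebra_simps)

lemma mem_perp_span [simp]: "w \<in> perp (span {v}) \<longleftrightarrow> lorentz w v = 0"
  unfolding perp_def using span_base[of v "{v}"] by (auto simp: span_singleton)

lemma mem_perp_Un [simp]: "w \<in> perp (a \<union> b) \<longleftrightarrow> w \<in> perp a \<and> w \<in> perp b"
  unfolding perp_def by blast

lemma orthogonal_lines_span [simp]:
  "orthogonal_lines (span {u}) (span {v}) \<longleftrightarrow> lorentz u v = 0"
  unfolding orthogonal_lines_def using span_base[of u "{u}"]
  by (auto simp: subset_iff span_singleton[of u] simp del: split_paired_All)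

lemma conformal_sphereE:
  assumes "a \<in> conformal_sphere"
  obtains A where "a = span {A}" "A \<noteq> 0" "lorentz A A = 0"
  using assms by (auto simp: conformal_sphere_def light_cone_def)

lemma span_scaleR: "r \<noteq> 0 \<Longrightarrow> span {r *\<^sub>R v} = span {v :: r41}"
  by (simp add: span_image_scale[of "{v}" "\<lambda>_. r", simplified])

text \<open>A generator of a null line can be scaled to have inner product \<open>1\<close> with any given vector
  that the line is not orthogonal to; this removes most denominators below.\<close>

lemma conformal_sphere_normalizedE:
  assumes "b \<in> conformal_sphere" "\<not> orthogonal_lines (span {A}) b"
  obtains B where "b = span {B}" "lorentz B B = 0" "lorentz A B = 1"
proof -
  obtain B where B: "b = span {B}" "lorentz B B = 0"
    using assms(1) by (elim conformal_sphereE)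
  then have "lorentz A B \<noteq> 0"
    using assms(2) by simp
  then show thesis
    using B by (intro that[of "inverse (lorentz A B) *\<^sub>R B"]) (simp_all add: span_scaleR)
qed


section \<open>Boosts in coordinates\<close>

definition boost :: "r41 \<Rightarrow> r41 \<Rightarrow> real \<Rightarrow> r41 \<Rightarrow> r41" where
  "boost A B s w = w + ((inverse s - 1) * lorentz w B / lorentz A B) *\<^sub>R A
     + ((s - 1) * lorentz w A / lorentz A B) *\<^sub>R B"

lemma linear_boost: "linear (boost A B s)"
  by (rule linearI) (simp_all add: boost_def algebra_simps add_divide_distrib diff_divide_distrib)

text \<open>The uniqueness implicit in the definition of \<open>line_boost\<close> holds because every vector is
  the sum of its components in the two lines and in their common orthogonal complement.\<close>

lemma line_boost_span:
  assumes "lorentz A A = 0" "lorentz B B = 0" "lorentz A B \<noteq> 0"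
  shows "line_boost (span {A}) (span {B}) s = boost A B s"
  unfolding line_boost_def
proof (rule the_equality)
  have BA: "lorentz B A = lorentz A B"
    by (rule lorentz_commute)
  show "linear (boost A B s) \<and> (\<forall>v\<in>span {B}. boost A B s v = s *\<^sub>R v)
      \<and> (\<forall>u\<in>span {A}. boost A B s u = inverse s *\<^sub>R u)
      \<and> (\<forall>w\<in>perp (span {A} \<union> span {B}). boost A B s w = w)"
  proof (intro conjI ballI)
    show "linear (boost A B s)"
      by (rule linear_boost)
    show "boost A B s v = s *\<^sub>R v" if "v \<in> span {B}" for v
      using that assms BA by (auto simp: boost_def span_singleton algebra_simps diff_divide_distrib)
    show "boost A B s v = inverse s *\<^sub>R v" if "v \<in> span {A}" for v
      using that assms BA by (auto simp: boost_def span_singleton algebra_simps diff_divide_distrib)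
    show "boost A B s w = w" if "w \<in> perp (span {A} \<union> span {B})" for w
      using that by (simp add: boost_def)
  qed
next
  fix T
  assume T: "linear T \<and> (\<forall>v\<in>span {B}. T v = s *\<^sub>R v)
      \<and> (\<forall>u\<in>span {A}. T u = inverse s *\<^sub>R u)
      \<and> (\<forall>w\<in>perp (span {A} \<union> span {B}). T w = w)"
  show "T = boost A B s"
  proof
    fix w
    define x y where "x = lorentz w B / lorentz A B" and "y = lorentz w A / lorentz A B"
    define w' where "w' = w - x *\<^sub>R A - y *\<^sub>R B"
    have "w' \<in> perp (span {A} \<union> span {B})"
      using assms by (simp add: w'_def x_def y_def lorentz_commute[of B A])
    then have "T w' = w'"
      using T by blast
    moreover have "T A = inverse s *\<^sub>R A" "T B = s *\<^sub>R B"
      using T by (auto simp: span_base)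
    moreover have "w = w' + x *\<^sub>R A + y *\<^sub>R B"
      by (simp add: w'_def)
    ultimately have "T w = w' + x *\<^sub>R inverse s *\<^sub>R A + y *\<^sub>R s *\<^sub>R B"
      using T by (metis (no_types) linear_add[of T] linear_scale[of T])
    then show "T w = boost A B s w"
      by (simp add: boost_def w'_def x_def y_def algebra_simps diff_divide_distrib)
  qed
qed

lemma lorentz_boost:
  assumes "lorentz A A = 0" "lorentz B B = 0" "lorentz A B \<noteq> 0" "s \<noteq> 0"
  shows "lorentz (boost A B s v) (boost A B s w) = lorentz v w"
proof -
  define p r where "p = inverse s - 1" and "r = s - 1"
  define x y x' y' where "x = lorentz v A" and "y = lorentz v B"
    and "x' = lorentz w A" and "y' = lorentz w B"
  have comm: "lorentz B A = lorentz A B" "lorentz A w = x'" "lorentz B w = y'"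
    by (simp_all add: x'_def y'_def lorentz_commute)
  have "p + r + p * r = 0"
    using assms(4) by (simp add: p_def r_def algebra_simps)
  moreover have "lorentz (boost A B s v) (boost A B s w)
      = lorentz v w + (p + r + p * r) * (y * x' + x * y') / lorentz A B"
    using assms(1-3)
    by (simp add: boost_def comm add_divide_distrib ring_distribs ac_simps
        flip: p_def r_def x_def y_def x'_def y'_def)
  ultimately show ?thesis
    by simp
qed

lemma line_boost_swap:
  assumes "a \<in> conformal_sphere" "b \<in> conformal_sphere" "\<not> orthogonal_lines a b"
  shows "line_boost b a (inverse s) = line_boost a b s"
proof -
  obtain A where A: "a = span {A}" "lorentz A A = 0"
    using assms(1) by (elim conformal_sphereE)
  obtain B where B: "b = span {B}" "lorentz B B = 0" "lorentz A B = 1"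
    using assms(2,3) A by (metis conformal_sphere_normalizedE)
  have "lorentz B A = 1"
    using B(3) by (simp add: lorentz_commute)
  then have "line_boost b a (inverse s) w = line_boost a b s w" for w
    using A B by (simp add: line_boost_span) (simp add: boost_def)
  then show ?thesis
    by (rule ext)
qed

lemma lorentz_line_boost:
  assumes "a \<in> conformal_sphere" "b \<in> conformal_sphere" "\<not> orthogonal_lines a b" "s \<noteq> 0"
  shows "lorentz (line_boost a b s v) (line_boost a b s w) = lorentz v w"
  using assms by (elim conformal_sphereE) (simp add: line_boost_span lorentz_boost)

lemma line_boost_perp:
  assumes "a \<in> conformal_sphere" "b \<in> conformal_sphere" "\<not> orthogonal_lines a b" "s \<noteq> 0"
    and "w \<in> perp d"
  shows "line_boost a b s w \<in> perp (line_boost a b s ` d)"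
  using assms by (simp add: perp_def lorentz_line_boost)

lemma line_boost_conformal_sphere:
  assumes "a \<in> conformal_sphere" "b \<in> conformal_sphere" "\<not> orthogonal_lines a b" "s \<noteq> 0"
    and "d \<in> conformal_sphere" "\<not> orthogonal_lines a d"
  shows "line_boost a b s ` d \<in> conformal_sphere"
proof -
  obtain A B D where A: "a = span {A}" "A \<noteq> 0" "lorentz A A = 0"
    and B: "b = span {B}" "lorentz B B = 0"
    and D: "d = span {D}" "lorentz D D = 0"
    using assms by (elim conformal_sphereE) blast
  have AB: "lorentz A B \<noteq> 0" and AD: "lorentz A D \<noteq> 0"
    using assms A B D by auto
  have "lorentz (boost A B s A) (boost A B s D) \<noteq> 0"
    using A B AB AD assms(4) by (simp add: lorentz_boost)
  then have "boost A B s D \<noteq> 0"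
    by auto
  moreover have "lorentz (boost A B s D) (boost A B s D) = 0"
    using A B D AB assms(4) by (simp add: lorentz_boost)
  moreover have "line_boost a b s ` d = span {boost A B s D}"
    using A B D AB by (simp add: line_boost_span linear_span_image[OF linear_boost, symmetric])
  ultimately show ?thesis
    unfolding conformal_sphere_def light_cone_def by blast
qed


section \<open>Conserved quantities along an edge\<close>

definition conserved_along_edge ::
    "r41 \<Rightarrow> real \<Rightarrow> r41 set \<Rightarrow> r41 set \<Rightarrow> r41 \<Rightarrow> r41 \<Rightarrow> bool" where
  "conserved_along_edge q \<mu> a b Y Z \<longleftrightarrow>
     (\<forall>t. t \<noteq> \<mu> \<longrightarrow> line_boost a b (1 - t / \<mu>) (q + t *\<^sub>R Y) = q + t *\<^sub>R Z)"

text \<open>A single \<open>t \<noteq> 0\<close> at which the transport is defined already determines the new linear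
  coefficient. On a quadrilateral it is thus enough to compare the two transports at one \<open>t\<close>
  that is generic for both parameters.\<close>

lemma conserved_along_edge_determined:
  assumes "t \<noteq> 0" "t \<noteq> \<mu>" "conserved_along_edge q \<mu> a b Y Z"
    and "line_boost a b (1 - t / \<mu>) (q + t *\<^sub>R Y) = q + t *\<^sub>R Z'"
  shows "Z' = Z"
  using assms by (auto simp: conserved_along_edge_def)

lemma conserved_along_edge_unique:
  assumes "\<mu> \<noteq> 0" "conserved_along_edge q \<mu> a b Y Z" "conserved_along_edge q \<mu> a b Y Z'"
  shows "Z' = Z"
proof -
  have t: "- \<mu> \<noteq> 0" "- \<mu> \<noteq> \<mu>"
    using assms(1) by auto
  show ?thesis
    using assms(3) t(2) unfolding conserved_along_edge_def
    by (intro conserved_along_edge_determined[OF t assms(2)]) blast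
qed

text \<open>Both sides of \<open>(q + tZ, q + tZ) = (q + tY, q + tY)\<close> are quadratic in \<open>t\<close> with the same
  constant term, so two nonzero values of \<open>t\<close> other than \<open>\<mu>\<close> give the remaining two
  coefficients.\<close>

lemma conserved_along_edge_lorentz:
  assumes "a \<in> conformal_sphere" "b \<in> conformal_sphere" "\<not> orthogonal_lines a b" "\<mu> \<noteq> 0"
    and "conserved_along_edge q \<mu> a b Y Z"
  shows "lorentz Z Z = lorentz Y Y" "lorentz q Z = lorentz q Y"
proof -
  have poly: "2 * t * lorentz q Z + t\<^sup>2 * lorentz Z Z = 2 * t * lorentz q Y + t\<^sup>2 * lorentz Y Y"
    if "t \<noteq> \<mu>" for t
  proof -
    have t: "1 - t / \<mu> \<noteq> 0"
      using assms(4) that by (simp add: field_simps)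
    have "line_boost a b (1 - t / \<mu>) (q + t *\<^sub>R Y) = q + t *\<^sub>R Z"
      using assms(5) that by (simp add: conserved_along_edge_def)
    then have "lorentz (q + t *\<^sub>R Z) (q + t *\<^sub>R Z) = lorentz (q + t *\<^sub>R Y) (q + t *\<^sub>R Y)"
      using lorentz_line_boost[OF assms(1-3) t, of "q + t *\<^sub>R Y" "q + t *\<^sub>R Y"] by simp
    then show ?thesis
      by (simp add: lorentz_commute[of Z q] lorentz_commute[of Y q] power2_eq_square
          algebra_simps)
  qed
  have "2 * \<mu> \<noteq> \<mu>" "- \<mu> \<noteq> \<mu>"
    using assms(4) by auto
  note eqs = poly[OF this(1)] poly[OF this(2)]
  have *: "2 * \<mu> * (2 * (lorentz q Z - lorentz q Y) + 2 * \<mu> * (lorentz Z Z - lorentz Y Y)) = 0"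
    "\<mu> * (\<mu> * (lorentz Z Z - lorentz Y Y) - 2 * (lorentz q Z - lorentz q Y)) = 0"
    using eqs by (simp_all add: power2_eq_square algebra_simps)
  then have "2 * (lorentz q Z - lorentz q Y) + 2 * \<mu> * (lorentz Z Z - lorentz Y Y) = 0"
    "\<mu> * (lorentz Z Z - lorentz Y Y) - 2 * (lorentz q Z - lorentz q Y) = 0"
    using assms(4) by simp_all
  then have "3 * (\<mu> * (lorentz Z Z - lorentz Y Y)) = 0"
    by argo
  then show ZY: "lorentz Z Z = lorentz Y Y"
    using assms(4) by simp
  show "lorentz q Z = lorentz q Y"
    using *(2) assms(4) ZY by simp
qed

text \<open>The second condition makes the \<open>a\<close>-component of \<open>q + tY\<close> proportional to \<open>1 - t/\<mu>\<close>, which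
  cancels the pole of the boost; the first makes the \<open>b\<close>-component constant, so that the image
  stays linear in \<open>t\<close>. The property \<open>Z \<perp> b\<close> is the first condition for the edges leaving
  \<open>b\<close>.\<close>

lemma conserved_along_edge_exists:
  assumes "a \<in> conformal_sphere" "b \<in> conformal_sphere" "\<not> orthogonal_lines a b" "\<mu> \<noteq> 0"
    and "Y \<in> perp a" "q + \<mu> *\<^sub>R Y \<in> perp b"
  obtains Z where "conserved_along_edge q \<mu> a b Y Z" "Z \<in> perp b"
proof -
  obtain A where A: "a = span {A}" "lorentz A A = 0"
    using assms(1) by (elim conformal_sphereE)
  obtain B where B: "b = span {B}" "lorentz B B = 0" "lorentz A B = 1"
    using assms(2,3) A by (metis conformal_sphere_normalizedE)
  have YA: "lorentz Y A = 0" and qB: "lorentz q B = - \<mu> * lorentz Y B"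
    using assms(5,6) A B by (simp_all)
  define Z where "Z = Y - lorentz Y B *\<^sub>R A - (lorentz q A / \<mu>) *\<^sub>R B"
  show thesis
  proof
    show "Z \<in> perp b"
      using A B by (simp add: Z_def)
    show "conserved_along_edge q \<mu> a b Y Z"
      unfolding conserved_along_edge_def
    proof (intro allI impI)
      fix t assume t: "t \<noteq> \<mu>"
      have "(inverse (1 - t / \<mu>) - 1) * lorentz (q + t *\<^sub>R Y) B = - t * lorentz Y B"
        using t assms(4) qB by (simp add: field_simps)
      moreover have "(1 - t / \<mu> - 1) * lorentz (q + t *\<^sub>R Y) A = - t * (lorentz q A / \<mu>)"
        using YA by simp
      ultimately show "line_boost a b (1 - t / \<mu>) (q + t *\<^sub>R Y) = q + t *\<^sub>R Z"
        using A B by (simp only: line_boost_span boost_def) (simp add: Z_def algebra_simps)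
    qed
  qed
qed

lemma darboux_quantity_conserved:
  assumes "f x \<in> conformal_sphere" "g x \<in> conformal_sphere" "\<not> orthogonal_lines (f x) (g x)"
    and "\<mu> \<noteq> 0" "Y x \<in> perp (f x)" "q + \<mu> *\<^sub>R Y x \<in> perp (g x)"
  shows "conserved_along_edge q \<mu> (f x) (g x) (Y x) (darboux_quantity f g \<mu> q Y x)"
    and "darboux_quantity f g \<mu> q Y x \<in> perp (g x)"
proof -
  obtain Z where Z: "conserved_along_edge q \<mu> (f x) (g x) (Y x) Z" "Z \<in> perp (g x)"
    using conserved_along_edge_exists[OF assms] by blast
  have "darboux_quantity f g \<mu> q Y x = Z"
    unfolding darboux_quantity_def
  proof (rule the_equality)
    show "\<forall>t. t \<noteq> \<mu> \<longrightarrow> q + t *\<^sub>R Z = line_boost (f x) (g x) (1 - t / \<mu>) (q + t *\<^sub>R Y x)"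
      using Z(1) by (simp add: conserved_along_edge_def)
  next
    fix Z'
    assume Z': "\<forall>t. t \<noteq> \<mu> \<longrightarrow> q + t *\<^sub>R Z' = line_boost (f x) (g x) (1 - t / \<mu>) (q + t *\<^sub>R Y x)"
    then have "conserved_along_edge q \<mu> (f x) (g x) (Y x) Z'"
      by (simp add: conserved_along_edge_def)
    with assms(4) Z(1) show "Z' = Z"
      by (rule conserved_along_edge_unique)
  qed
  with Z show "conserved_along_edge q \<mu> (f x) (g x) (Y x) (darboux_quantity f g \<mu> q Y x)"
    "darboux_quantity f g \<mu> q Y x \<in> perp (g x)"
    by simp_all
qed


section \<open>Bianchi permutability\<close>

text \<open>The vectors \<open>\<Gamma>\<^sub>a\<^sup>b(1 - \<nu>/\<mu>) D\<close> and \<open>\<Gamma>\<^sub>a\<^sup>d(1 - \<mu>/\<nu>) B\<close> are proportional with factor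
  \<open>- \<nu>/\<mu>\<close> when \<open>B\<close> and \<open>D\<close> have the same inner product with a generator of \<open>a\<close>.\<close>

lemma bianchi_quadrilateral_swap:
  assumes "a \<in> conformal_sphere" "b \<in> conformal_sphere" "d \<in> conformal_sphere"
    and "\<not> orthogonal_lines a b" "\<not> orthogonal_lines a d"
    and par: "\<mu> \<noteq> 0" "\<nu> \<noteq> 0" "\<mu> \<noteq> \<nu>"
    and quad: "bianchi_quadrilateral \<mu> \<nu> a b c d"
  shows "bianchi_quadrilateral \<nu> \<mu> a d c b"
proof -
  obtain A where A: "a = span {A}" "lorentz A A = 0"
    using assms(1) by (elim conformal_sphereE)
  obtain B where B: "b = span {B}" "lorentz B B = 0" "lorentz A B = 1"
    using assms(2,4) A by (metis conformal_sphere_normalizedE)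
  obtain D where D: "d = span {D}" "lorentz D D = 0" "lorentz A D = 1"
    using assms(3,5) A by (metis conformal_sphere_normalizedE)
  have comm: "lorentz B A = 1" "lorentz D A = 1" "lorentz D B = lorentz B D"
    using B D by (simp_all add: lorentz_commute[of B A] lorentz_commute[of D A] lorentz_commute[of D B])
  define r where "r = inverse (1 - \<mu> / \<nu>) - 1"
  have "inverse (1 - \<nu> / \<mu>) - 1 = - (\<nu> / \<mu>) * r"
    using par by (simp add: r_def field_simps)
  then have "boost A B (1 - \<nu> / \<mu>) D = - (\<nu> / \<mu>) *\<^sub>R boost A D (1 - \<mu> / \<nu>) B"
    using par B D comm
    by (simp add: boost_def scaleR_right_distrib scaleR_right_diff_distrib flip: r_def)
  moreover have "- (\<nu> / \<mu>) \<noteq> 0"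
    using par by simp
  ultimately have "span {boost A B (1 - \<nu> / \<mu>) D} = span {boost A D (1 - \<mu> / \<nu>) B}"
    by (metis span_scaleR)
  then show ?thesis
    using A B D quad
    by (simp add: bianchi_quadrilateral_def line_boost_span
        linear_span_image[OF linear_boost, symmetric])
qed

text \<open>Both sides differ from the identity by combinations of \<open>A\<close>, \<open>B\<close> and \<open>D\<close>, and the proof
  compares coefficients. The coefficient of \<open>A\<close> cancels on the left, which is what makes the
  composition a boost with respect to the diagonal \<open>B\<close>, \<open>D\<close>. The factor is forced: on \<open>B\<close> the
  first boost acts as \<open>1 - t/\<mu>\<close> and the second as the inverse of \<open>1 - t/\<nu>\<close>.\<close>

lemma boost_comp_boost:
  assumes null: "lorentz A A = 0" "lorentz B B = 0" "lorentz D D = 0"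
    and norm: "lorentz A B = 1" "lorentz A D = 1" and BD: "lorentz B D \<noteq> 0"
    and par: "\<mu> \<noteq> 0" "\<nu> \<noteq> 0" "\<mu> \<noteq> \<nu>" "t \<noteq> \<mu>" "t \<noteq> \<nu>"
    and C: "C = boost A B (1 - \<nu> / \<mu>) D"
  shows "boost B C (1 - t / \<nu>) (boost A B (1 - t / \<mu>) w)
    = boost B D ((1 - t / \<nu>) / (1 - t / \<mu>)) w"
proof -
  define k where "k = lorentz B D"
  have comm: "lorentz B A = 1" "lorentz D A = 1" "lorentz D B = k"
    using norm by (simp_all add: lorentz_commute[of B A] lorentz_commute[of D A] lorentz_commute[of D B] k_def)
  have nz: "\<mu> - \<nu> \<noteq> 0" "\<mu> - t \<noteq> 0" "\<nu> - t \<noteq> 0" "k \<noteq> 0"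
    using par BD by (auto simp: k_def)
  have inv: "inverse (1 - r / m) - 1 = r / (m - r)" if "m \<noteq> 0" "r \<noteq> m" for r m :: real
    using that by (simp add: field_simps)
  have C': "C = D + (\<nu> / (\<mu> - \<nu>) * k) *\<^sub>R A - (\<nu> / \<mu>) *\<^sub>R B"
    using par by (simp add: C boost_def inv norm comm)
  have BC: "lorentz B C = \<mu> * k / (\<mu> - \<nu>)" and AC: "lorentz A C = 1 - \<nu> / \<mu>"
    using par by (simp_all add: C' norm comm null k_def[symmetric] field_simps)
  define x y z where "x = lorentz w A" and "y = lorentz w B" and "z = lorentz w D"
  \<comment> \<open>\<open>(\<nu> - t) e\<close> is the inner product of \<open>C\<close> with the image of \<open>w\<close> under the first boost.\<close>
  define e where "e = z / (\<nu> - t) + k / (\<mu> - \<nu>) * x - y / (\<mu> - t)"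
  define w' where "w' = w + (t / (\<mu> - t) * y) *\<^sub>R A - (t / \<mu> * x) *\<^sub>R B"
  have w': "boost A B (1 - t / \<mu>) w = w'"
    using par by (simp add: w'_def boost_def inv norm x_def y_def)
  have w'B: "lorentz w' B = \<mu> / (\<mu> - t) * y"
    using nz by (simp add: w'_def null norm flip: y_def) (simp add: field_simps)
  have w'C: "lorentz w' C = (\<nu> - t) * e"
  proof -
    have *: "z + n * r * x + - n / p * y = n * (z / n + r * x - y / p)" if "n \<noteq> 0" for n r p
      using that by (simp add: algebra_simps)
    have "lorentz w' C = z + (\<nu> / (\<mu> - \<nu>) * k - t / \<mu> * (\<mu> * k / (\<mu> - \<nu>))) * x
        + (t / (\<mu> - t) * (1 - \<nu> / \<mu>) - \<nu> / \<mu>) * y"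
      unfolding w'_def lorentz_algebra AC BC
      by (simp add: C' algebra_simps flip: x_def y_def z_def)
    also have "\<nu> / (\<mu> - \<nu>) * k - t / \<mu> * (\<mu> * k / (\<mu> - \<nu>)) = (\<nu> - t) * (k / (\<mu> - \<nu>))"
      using par(1) by (simp add: algebra_simps diff_divide_distrib)
    also have "t / (\<mu> - t) * (1 - \<nu> / \<mu>) - \<nu> / \<mu> = - (\<nu> - t) / (\<mu> - t)"
      using nz par(1) by (simp add: field_simps)
    also have "z + (\<nu> - t) * (k / (\<mu> - \<nu>)) * x + - (\<nu> - t) / (\<mu> - t) * y = (\<nu> - t) * e"
      using * nz(3) by (simp only: e_def)
    finally show ?thesis .
  qed
  define g h where "g = t * (\<mu> - \<nu>) / (\<mu> * k)" and "h = t * (\<mu> - \<nu>) / (\<nu> * k)"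
  have "boost B C (1 - t / \<nu>) w' = w' + (g * e) *\<^sub>R B - (h * (y / (\<mu> - t))) *\<^sub>R C"
  proof -
    have "(inverse (1 - t / \<nu>) - 1) * lorentz w' C / lorentz B C = g * e"
      unfolding inv[OF par(2,5)] w'C BC g_def using nz par(1) by (simp add: field_simps)
    moreover have "(1 - t / \<nu> - 1) * lorentz w' B / lorentz B C = - (h * (y / (\<mu> - t)))"
      unfolding w'B BC h_def using nz par(1,2) by (simp add: field_simps)
    ultimately show ?thesis
      unfolding boost_def by simp
  qed
  also have "\<dots> = w + (t / (\<mu> - t) * y - h * (y / (\<mu> - t)) * (\<nu> / (\<mu> - \<nu>) * k)) *\<^sub>R A
      + (g * e - t / \<mu> * x + h * (y / (\<mu> - t)) * (\<nu> / \<mu>)) *\<^sub>R B - (h * (y / (\<mu> - t))) *\<^sub>R D"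
    by (simp add: w'_def C' algebra_simps)
  also have "t / (\<mu> - t) * y - h * (y / (\<mu> - t)) * (\<nu> / (\<mu> - \<nu>) * k) = 0"
    unfolding h_def using nz par(2) by simp
  also have "g * e - t / \<mu> * x + h * (y / (\<mu> - t)) * (\<nu> / \<mu>) = g * (z / (\<nu> - t))"
  proof -
    have "g * (k / (\<mu> - \<nu>)) = t / \<mu>" "h * (\<nu> / \<mu>) = g"
      unfolding g_def h_def using nz par(1,2) by simp_all
    moreover have "g * e = g * (z / (\<nu> - t)) + g * (k / (\<mu> - \<nu>)) * x - g * (y / (\<mu> - t))"
      by (simp add: e_def distrib_left right_diff_distrib)
    moreover have "h * (y / (\<mu> - t)) * (\<nu> / \<mu>) = h * (\<nu> / \<mu>) * (y / (\<mu> - t))"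
      by (simp only: ac_simps)
    ultimately show ?thesis
      by simp
  qed
  finally have "boost B C (1 - t / \<nu>) w'
      = w + (g * (z / (\<nu> - t))) *\<^sub>R B - (h * (y / (\<mu> - t))) *\<^sub>R D"
    by simp
  moreover have "(inverse ((1 - t / \<nu>) / (1 - t / \<mu>)) - 1) * z / k = g * (z / (\<nu> - t))"
    and "((1 - t / \<nu>) / (1 - t / \<mu>) - 1) * y / k = - (h * (y / (\<mu> - t)))"
  proof -
    have "inverse ((1 - t / \<nu>) / (1 - t / \<mu>)) - 1 = t * (\<mu> - \<nu>) / (\<mu> * (\<nu> - t))"
      and "(1 - t / \<nu>) / (1 - t / \<mu>) - 1 = - (t * (\<mu> - \<nu>) / (\<nu> * (\<mu> - t)))"
      using nz par(1,2) by (simp_all add: field_simps)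
    then show "(inverse ((1 - t / \<nu>) / (1 - t / \<mu>)) - 1) * z / k = g * (z / (\<nu> - t))"
      and "((1 - t / \<nu>) / (1 - t / \<mu>) - 1) * y / k = - (h * (y / (\<mu> - t)))"
      by (simp_all add: g_def h_def)
  qed
  ultimately show ?thesis
    unfolding w' boost_def[of B D] k_def[symmetric] y_def[symmetric] z_def[symmetric] by simp
qed

text \<open>The diagonal \<open>b\<close>, \<open>d\<close> is non-orthogonal because \<open>\<Gamma>\<^sub>a\<^sup>b(1 - \<nu>/\<mu>)\<close> is an isometry that
  preserves \<open>b\<close> and maps \<open>d\<close> to \<open>c\<close>.\<close>

lemma line_boost_comp_line_boost:
  assumes "a \<in> conformal_sphere" "b \<in> conformal_sphere" "d \<in> conformal_sphere"
    and "\<not> orthogonal_lines a b" "\<not> orthogonal_lines a d" "\<not> orthogonal_lines b c"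
    and par: "\<mu> \<noteq> 0" "\<nu> \<noteq> 0" "\<mu> \<noteq> \<nu>" "t \<noteq> \<mu>" "t \<noteq> \<nu>"
    and quad: "bianchi_quadrilateral \<mu> \<nu> a b c d"
  shows "\<not> orthogonal_lines b d"
    and "line_boost b c (1 - t / \<nu>) \<circ> line_boost a b (1 - t / \<mu>)
      = line_boost b d ((1 - t / \<nu>) / (1 - t / \<mu>))"
proof -
  obtain A where A: "a = span {A}" "lorentz A A = 0"
    using assms(1) by (elim conformal_sphereE)
  obtain B where B: "b = span {B}" "lorentz B B = 0" "lorentz A B = 1"
    using assms(2,4) A by (metis conformal_sphere_normalizedE)
  obtain D where D: "d = span {D}" "lorentz D D = 0" "lorentz A D = 1"
    using assms(3,5) A by (metis conformal_sphere_normalizedE)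
  define C where "C = boost A B (1 - \<nu> / \<mu>) D"
  have c: "c = span {C}"
    using quad A B D
    by (simp add: bianchi_quadrilateral_def line_boost_span C_def
        linear_span_image[OF linear_boost, symmetric])
  have BC: "lorentz B C \<noteq> 0"
    using B c assms(6) by simp
  have s: "1 - \<nu> / \<mu> \<noteq> 0"
    using par by simp
  have "boost A B (1 - \<nu> / \<mu>) B = (1 - \<nu> / \<mu>) *\<^sub>R B"
    using B by (simp add: boost_def lorentz_commute[of B A] algebra_simps)
  then have "lorentz B D = (1 - \<nu> / \<mu>) * lorentz B C"
    using lorentz_boost[OF A(2) B(2) _ s, of B D] B by (simp add: C_def)
  then have BD: "lorentz B D \<noteq> 0"
    using BC s by simp
  then show "\<not> orthogonal_lines b d"
    using B D by simp
  have "lorentz C C = 0"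
    using A B D s by (simp add: C_def lorentz_boost)
  then have "line_boost b c (1 - t / \<nu>) = boost B C (1 - t / \<nu>)"
    "line_boost a b (1 - t / \<mu>) = boost A B (1 - t / \<mu>)"
    "line_boost b d ((1 - t / \<nu>) / (1 - t / \<mu>)) = boost B D ((1 - t / \<nu>) / (1 - t / \<mu>))"
    using A B D BC BD c by (simp_all add: line_boost_span)
  then show "line_boost b c (1 - t / \<nu>) \<circ> line_boost a b (1 - t / \<mu>)
      = line_boost b d ((1 - t / \<nu>) / (1 - t / \<mu>))"
    using boost_comp_boost[OF A(2) B(2) D(2) B(3) D(3) BD par C_def] by (intro ext) simp
qed

text \<open>The transports over \<open>b\<close> and over \<open>d\<close> are the boosts of the same diagonal with inverse
  factors and exchanged lines, hence equal.\<close>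

lemma bianchi_permutability:
  assumes ends: "a \<in> conformal_sphere" "b \<in> conformal_sphere" "d \<in> conformal_sphere"
    and "\<not> orthogonal_lines a b" "\<not> orthogonal_lines a d"
    and "\<not> orthogonal_lines b c" "\<not> orthogonal_lines d c"
    and par: "\<mu> \<noteq> 0" "\<nu> \<noteq> 0" "\<mu> \<noteq> \<nu>" and t: "t \<noteq> \<mu>" "t \<noteq> \<nu>"
    and quad: "bianchi_quadrilateral \<mu> \<nu> a b c d"
  shows "line_boost b c (1 - t / \<nu>) \<circ> line_boost a b (1 - t / \<mu>)
      = line_boost d c (1 - t / \<mu>) \<circ> line_boost a d (1 - t / \<nu>)"
proof -
  have quad': "bianchi_quadrilateral \<nu> \<mu> a d c b"
    by (rule bianchi_quadrilateral_swap[OF assms(1-5) par quad])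
  note left = line_boost_comp_line_boost[OF assms(1-3,4,5,6) par t quad]
  note right = line_boost_comp_line_boost(2)
    [OF assms(1,3,2,5,4,7) par(2,1) par(3)[symmetric] t(2,1) quad']
  have "(1 - t / \<mu>) / (1 - t / \<nu>) = inverse ((1 - t / \<nu>) / (1 - t / \<mu>))"
    by (rule inverse_divide[symmetric])
  then show ?thesis
    by (simp only: left(2) right line_boost_swap[OF ends(2,3) left(1)])
qed

text \<open>At \<open>t = \<nu>\<close> the transport along \<open>a\<close>, \<open>b\<close> is the very isometry that maps \<open>d\<close> to \<open>c\<close>. The
  condition that the edge from \<open>a\<close> to \<open>d\<close> needs is therefore carried to the opposite edge
  from \<open>b\<close> to \<open>c\<close>.\<close>

lemma conserved_along_edge_opposite_perp:
  assumes "a \<in> conformal_sphere" "b \<in> conformal_sphere" "\<not> orthogonal_lines a b"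
    and "\<mu> \<noteq> 0" "\<mu> \<noteq> \<nu>" "bianchi_quadrilateral \<mu> \<nu> a b c d"
    and "conserved_along_edge q \<mu> a b Y Z" "q + \<nu> *\<^sub>R Y \<in> perp d"
  shows "q + \<nu> *\<^sub>R Z \<in> perp c"
proof -
  have "q + \<nu> *\<^sub>R Z = line_boost a b (1 - \<nu> / \<mu>) (q + \<nu> *\<^sub>R Y)"
    using assms(5,7) by (simp add: conserved_along_edge_def)
  then show ?thesis
    using assms by (simp add: bianchi_quadrilateral_def line_boost_perp)
qed

text \<open>Transport over \<open>b\<close> and over \<open>d\<close> leads to the same conserved quantity at \<open>c\<close>: flatness is
  used at a value of \<open>t\<close> where both transports are defined.\<close>

lemma conserved_along_edge_quadrilateral:
  assumes "a \<in> conformal_sphere" "b \<in> conformal_sphere" "c \<in> conformal_sphere" "d \<in> conformal_sphere"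
    and "\<not> orthogonal_lines a b" "\<not> orthogonal_lines a d"
    and "\<not> orthogonal_lines b c" "\<not> orthogonal_lines d c"
    and par: "\<mu> \<noteq> 0" "\<nu> \<noteq> 0" "\<mu> \<noteq> \<nu>"
    and quad: "bianchi_quadrilateral \<mu> \<nu> a b c d"
    and ab: "conserved_along_edge q \<mu> a b Y Yb" "q + \<mu> *\<^sub>R Y \<in> perp b"
    and ad: "conserved_along_edge q \<nu> a d Y Yd" "Yd \<in> perp d"
    and bc: "conserved_along_edge q \<nu> b c Yb Yc"
  shows "conserved_along_edge q \<mu> d c Yd Yc" and "q + \<mu> *\<^sub>R Yd \<in> perp c"
proof -
  have "bianchi_quadrilateral \<nu> \<mu> a d c b"
    by (rule bianchi_quadrilateral_swap[OF assms(1,2,4-6) par quad])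
  then show perp: "q + \<mu> *\<^sub>R Yd \<in> perp c"
    using conserved_along_edge_opposite_perp[OF assms(1,4,6) par(2) par(3)[symmetric] _ ad(1) ab(2)]
    by blast
  obtain Z where Z: "conserved_along_edge q \<mu> d c Yd Z"
    using conserved_along_edge_exists[OF assms(4,3,8) par(1) ad(2) perp] by blast
  define t where "t = \<bar>\<mu>\<bar> + \<bar>\<nu>\<bar> + 1"
  have t: "t \<noteq> 0" "t \<noteq> \<mu>" "t \<noteq> \<nu>"
    by (auto simp: t_def)
  have "line_boost d c (1 - t / \<mu>) (line_boost a d (1 - t / \<nu>) (q + t *\<^sub>R Y))
      = line_boost b c (1 - t / \<nu>) (line_boost a b (1 - t / \<mu>) (q + t *\<^sub>R Y))"
    using bianchi_permutability[OF assms(1,2,4-8) par t(2,3) quad] by (simp add: fun_eq_iff del: split_paired_All)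
  then have "line_boost d c (1 - t / \<mu>) (q + t *\<^sub>R Yd) = q + t *\<^sub>R Yc"
    using ab(1) ad(1) bc t by (simp add: conserved_along_edge_def)
  then have "Yc = Z"
    using conserved_along_edge_determined[OF t(1,2) Z] by blast
  with Z show "conserved_along_edge q \<mu> d c Yd Yc"
    by simp
qed


section \<open>Propagation through a net of Bianchi quadrilaterals\<close>

definition bianchi_net ::
    "(nat \<Rightarrow> real) \<Rightarrow> (nat \<Rightarrow> real) \<Rightarrow> (nat \<Rightarrow> nat \<Rightarrow> r41 set) \<Rightarrow> bool" where
  "bianchi_net \<alpha> \<beta> F \<longleftrightarrow>
     (\<forall>m. \<alpha> m \<noteq> 0) \<and> (\<forall>n. \<beta> n \<noteq> 0) \<and> (\<forall>m n. \<alpha> m \<noteq> \<beta> n) \<and>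
     (\<forall>m n. F m n \<in> conformal_sphere
        \<and> \<not> orthogonal_lines (F m n) (F (Suc m) n)
        \<and> \<not> orthogonal_lines (F m n) (F m (Suc n))
        \<and> bianchi_quadrilateral (\<alpha> m) (\<beta> n) (F m n) (F (Suc m) n) (F (Suc m) (Suc n)) (F m (Suc n)))"

lemma bianchi_net_discrete_isothermic:
  assumes "bianchi_net \<alpha> \<beta> F"
  shows "discrete_isothermic F (\<lambda>m n. \<alpha> m) (\<lambda>m n. \<beta> n)"
  unfolding discrete_isothermic_def
proof (intro conjI allI impI)
  fix m n t
  have F: "F m n \<in> conformal_sphere" "\<not> orthogonal_lines (F m n) (F (Suc m) n)"
    "\<not> orthogonal_lines (F m n) (F m (Suc n))"
    "bianchi_quadrilateral (\<alpha> m) (\<beta> n) (F m n) (F (Suc m) n) (F (Suc m) (Suc n)) (F m (Suc n))"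
    and par: "\<alpha> m \<noteq> 0" "\<beta> n \<noteq> 0" "\<alpha> m \<noteq> \<beta> n" for m n
    using assms by (simp_all add: bianchi_net_def)
  show "F m n \<in> conformal_sphere" "\<not> orthogonal_lines (F m n) (F (Suc m) n)"
    "\<not> orthogonal_lines (F m n) (F m (Suc n))" "\<alpha> m \<noteq> 0" "\<beta> n \<noteq> 0"
    by (rule F par)+
  assume "t \<noteq> \<alpha> m \<and> t \<noteq> \<beta> n"
  then show "line_boost (F (Suc m) n) (F (Suc m) (Suc n)) (1 - t / \<beta> n)
        \<circ> line_boost (F m n) (F (Suc m) n) (1 - t / \<alpha> m)
      = line_boost (F m (Suc n)) (F (Suc m) (Suc n)) (1 - t / \<alpha> m)
        \<circ> line_boost (F m n) (F m (Suc n)) (1 - t / \<beta> n)"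
    using bianchi_permutability[OF F(1) F(1) F(1) F(2,3,3,2) par _ _ F(4)] by blast
qed (rule refl)+

text \<open>Besides the transport itself, a row carries the two orthogonality conditions under which
  \<open>conserved_along_edge_exists\<close> applies at each of its vertices.\<close>

definition conserved_along_row ::
    "r41 \<Rightarrow> (nat \<Rightarrow> real) \<Rightarrow> (nat \<Rightarrow> r41 set) \<Rightarrow> (nat \<Rightarrow> r41) \<Rightarrow> bool" where
  "conserved_along_row q \<mu> G y \<longleftrightarrow>
     (\<forall>m. y m \<in> perp (G m) \<and> q + \<mu> m *\<^sub>R y m \<in> perp (G (Suc m))
        \<and> conserved_along_edge q (\<mu> m) (G m) (G (Suc m)) (y m) (y (Suc m)))"

text \<open>The condition for the vertical edges starts on the left axis and moves to the right through
  the quadrilaterals, so each vertex of the row has a well-defined quantity above it. The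
  quadrilaterals then show that these form a conserved row.\<close>

lemma conserved_along_next_row:
  assumes net: "bianchi_net \<alpha> \<beta> F"
    and row: "conserved_along_row q \<alpha> (\<lambda>m. F m n) y"
    and col: "conserved_along_row q \<beta> (F 0) z"
    and "y 0 = z n"
  obtains y' where "conserved_along_row q \<alpha> (\<lambda>m. F m (Suc n)) y'" "y' 0 = z (Suc n)"
    "\<And>m. conserved_along_edge q (\<beta> n) (F m n) (F m (Suc n)) (y m) (y' m)"
proof -
  have par: "\<alpha> m \<noteq> 0" "\<beta> n \<noteq> 0" "\<alpha> m \<noteq> \<beta> n" for m
    using net by (auto simp: bianchi_net_def)
  have F: "F m n \<in> conformal_sphere" "\<not> orthogonal_lines (F m n) (F (Suc m) n)"
    "\<not> orthogonal_lines (F m n) (F m (Suc n))"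
    "bianchi_quadrilateral (\<alpha> m) (\<beta> n) (F m n) (F (Suc m) n) (F (Suc m) (Suc n)) (F m (Suc n))"
    for m n
    using net by (auto simp: bianchi_net_def)
  have y: "y m \<in> perp (F m n)" "q + \<alpha> m *\<^sub>R y m \<in> perp (F (Suc m) n)"
    "conserved_along_edge q (\<alpha> m) (F m n) (F (Suc m) n) (y m) (y (Suc m))" for m
    using row by (auto simp: conserved_along_row_def)
  have up: "q + \<beta> n *\<^sub>R y m \<in> perp (F m (Suc n))" for m
  proof (induction m)
    case 0
    show ?case
      using col assms(4) by (simp add: conserved_along_row_def)
  next
    case (Suc m)
    then show ?case
      using F par y by (intro conserved_along_edge_opposite_perp[OF _ _ _ _ _ F(4) y(3)]) auto
  qed
  have "\<exists>Z. conserved_along_edge q (\<beta> n) (F m n) (F m (Suc n)) (y m) Z \<and> Z \<in> perp (F m (Suc n))" for m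
    using conserved_along_edge_exists[OF F(1) F(1) F(3) par(2) y(1) up] by blast
  then obtain y' where y': "conserved_along_edge q (\<beta> n) (F m n) (F m (Suc n)) (y m) (y' m)"
    "y' m \<in> perp (F m (Suc n))" for m
    by metis
  show thesis
  proof
    show "conserved_along_edge q (\<beta> n) (F m n) (F m (Suc n)) (y m) (y' m)" for m
      by (rule y'(1))
    have "conserved_along_edge q (\<beta> n) (F 0 n) (F 0 (Suc n)) (y 0) (z (Suc n))"
      using col assms(4) by (simp add: conserved_along_row_def)
    then show "y' 0 = z (Suc n)"
      using y'(1) par(2) by (metis conserved_along_edge_unique)
    show "conserved_along_row q \<alpha> (\<lambda>m. F m (Suc n)) y'"
      unfolding conserved_along_row_def
      using y' conserved_along_edge_quadrilateral[OF F(1) F(1) F(1) F(1) F(2,3,3,2) par F(4) y(3,2) y' y'(1)]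
      by blast
  qed
qed

lemma bianchi_net_discrete_cmc:
  assumes net: "bianchi_net \<alpha> \<beta> F"
    and row: "conserved_along_row q \<alpha> (\<lambda>m. F m 0) y"
    and col: "conserved_along_row q \<beta> (F 0) z"
    and "y 0 = z 0" "lorentz (z 0) (z 0) = 1" "lorentz q (z 0) = - H"
    and "\<And>m n. point_in_space_form q (F m n)"
  shows "discrete_cmc_surface q H F"
proof -
  have "\<exists>Y. \<forall>n. (conserved_along_row q \<alpha> (\<lambda>m. F m n) (Y n) \<and> Y n 0 = z n) \<and>
    (\<forall>m. conserved_along_edge q (\<beta> n) (F m n) (F m (Suc n)) (Y n m) (Y (Suc n) m))"
  proof (rule dependent_nat_choice)
    show "\<exists>y. conserved_along_row q \<alpha> (\<lambda>m. F m 0) y \<and> y 0 = z 0"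
      using row assms(4) by blast
  next
    fix y n
    assume "conserved_along_row q \<alpha> (\<lambda>m. F m n) y \<and> y 0 = z n"
    then show "\<exists>y'. (conserved_along_row q \<alpha> (\<lambda>m. F m (Suc n)) y' \<and> y' 0 = z (Suc n)) \<and>
        (\<forall>m. conserved_along_edge q (\<beta> n) (F m n) (F m (Suc n)) (y m) (y' m))"
      by (metis conserved_along_next_row[OF net _ col])
  qed
  then obtain Y where Y0: "\<And>n. Y n 0 = z n"
    and row': "\<And>n. conserved_along_row q \<alpha> (\<lambda>m. F m n) (Y n)"
    and up: "\<And>m n. conserved_along_edge q (\<beta> n) (F m n) (F m (Suc n)) (Y n m) (Y (Suc n) m)"
    by auto
  have right: "conserved_along_edge q (\<alpha> m) (F m n) (F (Suc m) n) (Y n m) (Y n (Suc m))" for m n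
    using row' by (simp add: conserved_along_row_def)
  have F: "F m n \<in> conformal_sphere" "\<not> orthogonal_lines (F m n) (F (Suc m) n)"
    "\<not> orthogonal_lines (F m n) (F m (Suc n))" "\<alpha> m \<noteq> 0" "\<beta> n \<noteq> 0" for m n
    using net by (auto simp: bianchi_net_def)
  note right_lorentz = conserved_along_edge_lorentz[OF F(1) F(1) F(2) F(4) right]
  note up_lorentz = conserved_along_edge_lorentz[OF F(1) F(1) F(3) F(5) up]
  have Y: "lorentz (Y n m) (Y n m) = 1 \<and> lorentz q (Y n m) = - H" for m n
  proof (induction m)
    case 0
    show ?case
      by (induction n) (use assms(5,6) Y0[of 0] up_lorentz in auto)
  qed (use right_lorentz in auto)
  show ?thesis
    unfolding discrete_cmc_surface_def
    using assms(7) bianchi_net_discrete_isothermic[OF net] right up Y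
    by (intro conjI allI exI[of _ "\<lambda>m n. \<alpha> m"] exI[of _ "\<lambda>m n. \<beta> n"] exI[of _ "\<lambda>m n. Y n m"])
      (auto simp: conserved_along_edge_def)
qed


section \<open>Lattices of Darboux transforms\<close>

text \<open>The \<open>t\<^sup>2\<close>-coefficient of \<open>(d + t\<eta>)(q + tY) = 0\<close> is \<open>\<eta> Y = 0\<close>. At a direction in which
  \<open>\<eta> = u \<and> w\<close> is nonzero, \<open>u\<close> and \<open>w\<close> are linearly independent, and
  \<open>(u, Y) w - (w, Y) u = 0\<close> forces \<open>(u, Y) = 0\<close>, where \<open>u\<close> spans the line.\<close>

lemma linear_conserved_quantity_perp:
  assumes "smooth_2_manifold S A" "isothermic S A f \<eta>" "linear_conserved_quantity A \<eta> q Y"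
    and "x \<in> S"
  shows "Y x \<in> perp (f x)"
proof -
  obtain V \<psi> y where c: "(V, \<psi>) \<in> A" and y: "y \<in> V" "\<psi> y = x"
    using assms(1,4) unfolding smooth_2_manifold_def by blast
  let ?c = "(V, \<psi>)"
  obtain v w\<^sub>0 where nz: "\<eta> ?c y v w\<^sub>0 \<noteq> 0"
    using assms(2) c y unfolding isothermic_def nowhere_zero_form_def by fastforce
  obtain u w where u: "u \<in> f x" and \<eta>: "\<eta> ?c y v = wedge u w"
    using assms(2) c y unfolding isothermic_def by fastforce
  have "smooth_on V (Y \<circ> \<psi>)"
    using assms(3) c unfolding linear_conserved_quantity_def smooth_map_def by blast
  then have "Ck_on (Suc 0) V (Y \<circ> \<psi>)"
    unfolding smooth_on_def by blast
  then have "(\<lambda>z. Y (\<psi> z)) differentiable (at y)"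
    using y by (simp add: o_def)
  then obtain Y' where Y': "((\<lambda>z. Y (\<psi> z)) has_derivative Y') (at y)"
    by (auto simp: differentiable_def)
  have deriv: "t *\<^sub>R Y' v + t *\<^sub>R wedge u w (q + t *\<^sub>R Y x) = 0" for t
  proof -
    have "((\<lambda>z. q + t *\<^sub>R Y (\<psi> z)) has_derivative (\<lambda>v. t *\<^sub>R Y' v)) (at y)"
      by (auto intro!: derivative_eq_intros Y')
    then have "dir_deriv (\<lambda>z. q + t *\<^sub>R Y (\<psi> z)) y v = t *\<^sub>R Y' v"
      unfolding dir_deriv_def by (metis frechet_derivative_at)
    moreover have "connection \<eta> t ?c (\<lambda>z. q + t *\<^sub>R Y (\<psi> z)) y v = 0"
      using assms(3) c y unfolding linear_conserved_quantity_def by fastforce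
    ultimately show ?thesis
      by (simp add: connection_def \<eta> y)
  qed
  have "wedge u w (Y x) = 0"
  proof -
    \<comment> \<open>The values \<open>t = 1\<close> and \<open>t = - 1\<close> separate the even coefficient from the odd one.\<close>
    have "2 *\<^sub>R wedge u w (Y x) = (Y' v + wedge u w (q + Y x)) - (Y' v + wedge u w (q - Y x))"
      unfolding wedge_def scaleR_2 by (simp add: algebra_simps)
    also have "\<dots> = 0"
      using deriv[of 1] deriv[of "- 1"] by (simp add: algebra_simps)
    finally show ?thesis
      by simp
  qed
  then have dep: "lorentz u (Y x) *\<^sub>R w = lorentz w (Y x) *\<^sub>R u"
    by (simp add: wedge_def)
  have "lorentz u (Y x) = 0"
  proof (rule ccontr)
    assume "lorentz u (Y x) \<noteq> 0"
    then have "w = (lorentz w (Y x) / lorentz u (Y x)) *\<^sub>R u"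
      using dep by (metis divide_inverse_commute inverse_eq_divide right_inverse scaleR_one scaleR_scaleR mult.commute)
    then obtain r where "w = r *\<^sub>R u"
      by blast
    then have "wedge u w w\<^sub>0 = 0"
      by (simp add: wedge_def)
    then show False
      using nz \<eta> by simp
  qed
  moreover have "u \<noteq> 0"
    using nz \<eta> by (auto simp: wedge_def)
  moreover obtain X where "f x = span {X}"
    using assms(2,4) unfolding isothermic_def conformal_surface_def by (metis conformal_sphereE)
  ultimately show ?thesis
    using u by (auto simp: span_breakdown_eq lorentz_commute)
qed

lemma transform_sequence_conserved_along_row:
  assumes "transform_sequence (cmc_darboux_transform S A q) q \<eta> Y \<mu> g" "x \<in> S"
    and "g 0 x \<in> conformal_sphere" "Y x \<in> perp (g 0 x)"
  shows "conserved_along_row q \<mu> (\<lambda>m. g m x) (\<lambda>m. induced_quantity g \<mu> q Y m x)"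
    and "g m x \<in> conformal_sphere" "\<mu> m \<noteq> 0"
proof -
  have step: "\<mu> m \<noteq> 0" "g (Suc m) x \<in> conformal_sphere" "\<not> orthogonal_lines (g m x) (g (Suc m) x)"
    "q + \<mu> m *\<^sub>R induced_quantity g \<mu> q Y m x \<in> perp (g (Suc m) x)" for m
    using assms(1,2) unfolding transform_sequence_def cmc_darboux_transform_def
      darboux_transform_def conformal_surface_def by blast+
  show cs: "g m x \<in> conformal_sphere" for m
    using assms(3) step(2) by (cases m) auto
  show "\<mu> m \<noteq> 0"
    by (rule step)
  note conserved = darboux_quantity_conserved[of "g m" x "g (Suc m)" "\<mu> m" "induced_quantity g \<mu> q Y m" q for m,
      OF cs cs step(3,1) _ step(4)]
  have perp: "induced_quantity g \<mu> q Y m x \<in> perp (g m x)" for m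
    by (induction m) (use assms(4) conserved(2) in auto)
  show "conserved_along_row q \<mu> (\<lambda>m. g m x) (\<lambda>m. induced_quantity g \<mu> q Y m x)"
    using perp step(4) conserved(1)[OF perp] by (simp add: conserved_along_row_def)
qed

lemma transform_lattice_bianchi_net:
  assumes lat: "transform_lattice S T q \<eta> Y \<alpha> \<beta> f" and "x \<in> S"
    and "\<And>m. \<alpha> m \<noteq> 0" "\<And>n. \<beta> n \<noteq> 0"
    and bottom: "\<And>m. f m 0 x \<in> conformal_sphere" and left: "\<And>n. f 0 n x \<in> conformal_sphere"
  shows "bianchi_net \<alpha> \<beta> (\<lambda>m n. f m n x)"
proof -
  have par: "\<alpha> m \<noteq> \<beta> n" for m n
    using lat by (simp add: transform_lattice_def)
  have f: "bianchi_quadrilateral (\<alpha> m) (\<beta> n)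
        (f m n x) (f (Suc m) n x) (f (Suc m) (Suc n) x) (f m (Suc n) x)"
    "\<not> orthogonal_lines (f m n x) (f (Suc m) n x)"
    "\<not> orthogonal_lines (f m n x) (f m (Suc n) x)" for m n
    using lat assms(2) by (auto simp: transform_lattice_def)
  have "f m n x \<in> conformal_sphere" for m n
  proof (induction n arbitrary: m)
    case 0
    show ?case
      by (rule bottom)
  next
    case (Suc n)
    show ?case
    proof (induction m)
      case 0
      show ?case
        by (rule left)
    next
      case (Suc m)
      have "1 - \<beta> n / \<alpha> m \<noteq> 0"
        using par assms(3) by (simp add: field_simps)
      then have "line_boost (f m n x) (f (Suc m) n x) (1 - \<beta> n / \<alpha> m) ` f m (Suc n) x \<in> conformal_sphere"
        using Suc.IH \<open>\<And>m. f m n x \<in> conformal_sphere\<close> f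
        by (intro line_boost_conformal_sphere) auto
      then show ?case
        using f(1)[of m n] by (simp add: bianchi_quadrilateral_def)
    qed
  qed
  then show ?thesis
    using assms(3,4) par f by (simp add: bianchi_net_def)
qed

lemma transform_lattice_mono:
  assumes "transform_lattice S T q \<eta> Y \<alpha> \<beta> f" "\<And>f \<eta> Y \<mu> g. T f \<eta> Y \<mu> g \<Longrightarrow> T' f \<eta> Y \<mu> g"
  shows "transform_lattice S T' q \<eta> Y \<alpha> \<beta> f"
  using assms(1) unfolding transform_lattice_def transform_sequence_def
  by (elim conjE, intro conjI allI) (simp_all add: assms(2))

lemma cmc_darboux_lattice_discrete_cmc:
  assumes "smooth_2_manifold S A" "cmc_surface S A q H (f 0 0) \<eta> Y"
    and lat: "transform_lattice S (cmc_darboux_transform S A q) q \<eta> Y \<alpha> \<beta> f" and "x \<in> S"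
  shows "discrete_cmc_surface q H (\<lambda>m n. f m n x)"
proof -
  have "f 0 0 x \<in> conformal_sphere"
    using assms(2,4) by (auto simp: cmc_surface_def isothermic_def conformal_surface_def)
  moreover have "Y x \<in> perp (f 0 0 x)"
    using assms by (auto simp: cmc_surface_def intro: linear_conserved_quantity_perp)
  moreover have "transform_sequence (cmc_darboux_transform S A q) q \<eta> Y \<alpha> (\<lambda>m. f m 0)"
    "transform_sequence (cmc_darboux_transform S A q) q \<eta> Y \<beta> (\<lambda>n. f 0 n)"
    using lat by (simp_all add: transform_lattice_def)
  ultimately have
    row: "conserved_along_row q \<alpha> (\<lambda>m. f m 0 x) (\<lambda>m. induced_quantity (\<lambda>m. f m 0) \<alpha> q Y m x)"
      "f m 0 x \<in> conformal_sphere" "\<alpha> m \<noteq> 0"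
    and col: "conserved_along_row q \<beta> (\<lambda>n. f 0 n x) (\<lambda>n. induced_quantity (\<lambda>n. f 0 n) \<beta> q Y n x)"
      "f 0 n x \<in> conformal_sphere" "\<beta> n \<noteq> 0" for m n
    using \<open>x \<in> S\<close> transform_sequence_conserved_along_row[of S A q \<eta> Y] by auto
  have "bianchi_net \<alpha> \<beta> (\<lambda>m n. f m n x)"
    using lat \<open>x \<in> S\<close> row(3) col(3) row(2) col(2) by (rule transform_lattice_bianchi_net)
  moreover have "point_in_space_form q (f m n x)" for m n
    using lat \<open>x \<in> S\<close> by (simp add: transform_lattice_def)
  moreover have "lorentz (Y x) (Y x) = 1" "lorentz q (Y x) = - H"
    using assms(2,4) by (auto simp: cmc_surface_def)
  ultimately show ?thesis
    by (intro bianchi_net_discrete_cmc[OF _ row(1) col(1)]) auto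
qed

theorem corollary3p1:
  fixes S :: "'a::topological_space set" and A :: "'a param set"
    and q :: r41 and H :: real
    and f :: "nat \<Rightarrow> nat \<Rightarrow> 'a \<Rightarrow> r41 set"
    and \<eta> :: "'a endo_form" and Y :: "'a \<Rightarrow> r41"
    and \<alpha> \<beta> :: "nat \<Rightarrow> real"
  assumes "smooth_2_manifold S A" and "simply_connected S"
    and "q \<noteq> 0"
    and "cmc_surface S A q H (f 0 0) \<eta> Y"
  shows "(transform_lattice S (cmc_darboux_transform S A q) q \<eta> Y \<alpha> \<beta> f \<longrightarrow>
            (\<forall>x\<in>S. discrete_cmc_surface q H (\<lambda>m n. f m n x))) \<and>
         (lorentz q q = 0 \<and> transform_lattice S (bianchi_backlund_transform S A q) q \<eta> Y \<alpha> \<beta> f \<longrightarrow>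
            (\<forall>x\<in>S. discrete_cmc_surface q H (\<lambda>m n. f m n x)))"
proof -
  have cmc: "\<forall>x\<in>S. discrete_cmc_surface q H (\<lambda>m n. f m n x)"
    if "transform_lattice S (cmc_darboux_transform S A q) q \<eta> Y \<alpha> \<beta> f"
    using cmc_darboux_lattice_discrete_cmc[where f = f, OF assms(1,4) that] by (rule ballI)
  moreover have "transform_lattice S (cmc_darboux_transform S A q) q \<eta> Y \<alpha> \<beta> f"
    if "transform_lattice S (bianchi_backlund_transform S A q) q \<eta> Y \<alpha> \<beta> f"
    using that by (rule transform_lattice_mono) (unfold bianchi_backlund_transform_def, elim conjE)
  ultimately show ?thesis
    by (intro conjI impI) simp_all
qed

end
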